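(* Let $b>0$ and let $\mathcal{P}^{w.e.}(\zeta,t)$ be the limiting joint density at the weakly non-normal edge with parameter $b$ (given in the context). Then for every $\zeta\in\mathbb{R}$, $$\rho_b(\zeta):=\int_0^\infty\mathcal{P}^{w.e.}(\zeta,t)\,dt=\int_\zeta^\infty\mathrm{Ai}_b(p)^2\,dp+\frac12\mathrm{Ai}_b(\zeta)\left(1-\int_\zeta^\infty\mathrm{Ai}_b(p)\,dp\right).$$
   Context: Deformed Airy function: $\mathrm{Ai}_b(\zeta)=e^{\frac{b^2\zeta}{2}+\frac{b^6}{12}}\mathrm{Ai}\left(\zeta+\frac{b^4}{4}\right)$, where $\mathrm{Ai}$ is the Airy function. The function $\mathcal{P}^{w.e.}$, for $\zeta\in\mathbb{R}$ and $t>0$, is $$\mathcal{P}^{w.e.}(\zeta,t)=\frac{b^2}{t^2}\left[T_0(\zeta)+\frac{b^2T_1(\zeta)}{t}+\frac{b^4T_2(\zeta)}{t^2}+\frac{b^6T_3(\zeta)}{t^3}\right]\exp\left(\frac{b^2\zeta}{t}-\frac{b^6}{2t^2}-\frac{b^6}{3t^3}\right),$$ with $$T_3(\zeta)=\int_\zeta^\infty\left[\mathrm{Ai}_b'(p)^2-\mathrm{Ai}_b(p)\mathrm{Ai}_b''(p)\right]dp,$$ $$T_2(\zeta)=b^2T_3(\zeta)+\int_\zeta^\infty\mathrm{Ai}_b(p)^2dp,$$ $$T_1(\zeta)=-\zeta T_3(\zeta)+\tfrac12\mathrm{Ai}_b(\zeta)^2+b^2\int_\zeta^\infty\mathrm{Ai}_b(p)^2dp,$$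 $$T_0(\zeta)=-T_3(\zeta)+\tfrac12b^2\mathrm{Ai}_b(\zeta)^2-\tfrac12\mathrm{Ai}_b(\zeta)\mathrm{Ai}_b'(\zeta)-\zeta\int_\zeta^\infty\mathrm{Ai}_b(p)^2dp.$$ (It arises as the scaling limit, at the spectral edge and with $(1-\tau)N^{1/3}=b^2$, of the joint density of a real eigenvalue and its squared condition number minus one in the real elliptic Gaussian ensemble; the explicit formula above is taken as its definition here.) *)

theory Defs
  imports "HOL-Analysis.Analysis"
begin

text \<open>The Airy function on the real line. The integral over the half-line converges only
  conditionally, hence the limit of integrals over bounded intervals.\<close>

definition Airy_Ai :: "real \<Rightarrow> real" where
  "Airy_Ai x = Lim at_top (\<lambda>R. LBINT t:{0..R}. cos (t ^ 3 / 3 + x * t)) / pi"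

definition Ai_deformed :: "real \<Rightarrow> real \<Rightarrow> real" where
  "Ai_deformed b \<zeta> = exp (b^2 * \<zeta> / 2 + b^6 / 12) * Airy_Ai (\<zeta> + b^4 / 4)"

definition T3 :: "real \<Rightarrow> real \<Rightarrow> real" where
  "T3 b \<zeta> = (LBINT p:{\<zeta>..}.
     (deriv (Ai_deformed b) p)^2 - Ai_deformed b p * deriv (deriv (Ai_deformed b)) p)"

definition T2 :: "real \<Rightarrow> real \<Rightarrow> real" where
  "T2 b \<zeta> = b^2 * T3 b \<zeta> + (LBINT p:{\<zeta>..}. (Ai_deformed b p)^2)"

definition T1 :: "real \<Rightarrow> real \<Rightarrow> real" where
  "T1 b \<zeta> = - \<zeta> * T3 b \<zeta> + 1/2 * (Ai_deformed b \<zeta>)^2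
     + b^2 * (LBINT p:{\<zeta>..}. (Ai_deformed b p)^2)"

definition T0 :: "real \<Rightarrow> real \<Rightarrow> real" where
  "T0 b \<zeta> = - T3 b \<zeta> + 1/2 * b^2 * (Ai_deformed b \<zeta>)^2
     - 1/2 * Ai_deformed b \<zeta> * deriv (Ai_deformed b) \<zeta>
     - \<zeta> * (LBINT p:{\<zeta>..}. (Ai_deformed b p)^2)"

text \<open>The limiting joint density at the weakly non-normal edge, of interest for
  \<open>b > 0\<close> and \<open>t > 0\<close>.\<close>

definition P_we :: "real \<Rightarrow> real \<Rightarrow> real \<Rightarrow> real" where
  "P_we b \<zeta> t = b^2 / t^2 *
     (T0 b \<zeta> + b^2 * T1 b \<zeta> / t + b^4 * T2 b \<zeta> / t^2 + b^6 * T3 b \<zeta> / t^3) *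
     exp (b^2 * \<zeta> / t - b^6 / (2 * t^2) - b^6 / (3 * t^3))"

definition rho :: "real \<Rightarrow> real \<Rightarrow> real" where
  "rho b \<zeta> = (LBINT t:{0<..}. P_we b \<zeta> t)"

end

theory Submission
  imports Defs "HOL-Complex_Analysis.Cauchy_Integral_Theorem" "HOL-Probability.Characteristic_Functions"
begin

text \<open>
  Substituting \<open>s = b\<^sup>2 / t\<close> turns the density into a cubic polynomial in \<open>s\<close> times the weight
  \<open>E(s) = exp (s \<zeta> - b\<^sup>2 s\<^sup>2 / 2 - s\<^sup>3 / 3)\<close>. In the integral over \<open>s\<close> the coefficient of \<open>T3\<close> is
  \<open>- (s E)'\<close>, which integrates to 0, and that of \<open>J = \<integral>\<^sub>\<zeta> Ai_b\<^sup>2\<close> is \<open>- E'\<close>, which integrates to 1. What remains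
  is \<open>Ai_b / 2\<close> times \<open>G = Ai_b (F' + b\<^sup>2 F) - Ai_b' F\<close>, where \<open>F(\<zeta>) = \<integral> E(s) ds\<close>. Since
  \<open>Ai_b'' = b\<^sup>2 Ai_b' + \<zeta> Ai_b\<close> and \<open>F'' + b\<^sup>2 F' = \<zeta> F + 1\<close>, we have \<open>G' = Ai_b\<close>; moreover \<open>G\<close> vanishes at
  \<open>-\<infinity>\<close>, so \<open>G = 1 - \<integral>\<^sub>\<zeta> Ai_b\<close> because \<open>Ai_b\<close> has total integral 1. All facts about \<open>Ai_b\<close> follow
  from moving the contour of the Airy integral up by \<open>c = b\<^sup>2 / 2\<close>: this exhibits \<open>Ai_b\<close> as the inverse
  Fourier transform of \<open>exp (\<i> u\<^sup>3 / 3 - c u\<^sup>2)\<close>.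
\<close>

section \<open>Gaussian bounds and calculus of Lebesgue integrals\<close>

lemma integrable_gaussian:
  fixes c :: real
  assumes "c > 0"
  shows "integrable lborel (\<lambda>u::real. exp (- c * u\<^sup>2))"
proof -
  have "integrable lborel (\<lambda>u. sqrt (pi / c) * normal_density 0 (1 / sqrt (2 * c)) u)"
    using assms by (intro integrable_mult_right integrable_normal_density) simp
  moreover have "sqrt (pi / c) * normal_density 0 (1 / sqrt (2 * c)) u = exp (- c * u\<^sup>2)" for u
    using assms by (simp add: normal_density_def power_divide real_sqrt_divide)
  ultimately show ?thesis by simp
qed

text \<open>One term of the exponential series gives
  \<open>\<bar>u\<bar> ^ k \<le> fact k * exp \<bar>u\<bar>\<close>, which raises \<open>M\<close>
  to \<open>M + 1\<close>. Half of the Gaussian then absorbs the linear exponent by completing the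
  square, and the other half remains to provide integrability and decay.\<close>

lemma power_exp_le_gaussian:
  fixes u :: real
  assumes "c > 0"
  shows "\<bar>u\<bar> ^ k * exp (M * \<bar>u\<bar> - c * u\<^sup>2) \<le> fact k * exp ((M + 1)\<^sup>2 / (2 * c)) * exp (- (c / 2) * u\<^sup>2)"
proof -
  have "(\<Sum>n\<in>{k}. \<bar>u\<bar> ^ n /\<^sub>R fact n) \<le> (\<Sum>n. \<bar>u\<bar> ^ n /\<^sub>R fact n)"
    by (intro sum_le_suminf summable_exp_generic) auto
  then have "\<bar>u\<bar> ^ k / fact k \<le> exp \<bar>u\<bar>"
    by (simp add: exp_def field_simps)
  then have "\<bar>u\<bar> ^ k \<le> fact k * exp \<bar>u\<bar>"
    by (simp add: divide_le_eq mult.commute)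
  then have "\<bar>u\<bar> ^ k * exp (M * \<bar>u\<bar> - c * u\<^sup>2) \<le> fact k * exp \<bar>u\<bar> * exp (M * \<bar>u\<bar> - c * u\<^sup>2)"
    by (rule mult_right_mono) simp
  also have "\<dots> = fact k * exp ((M + 1) * \<bar>u\<bar> - c * u\<^sup>2)"
    by (simp add: exp_add [symmetric] algebra_simps)
  also have "\<dots> \<le> fact k * exp ((M + 1)\<^sup>2 / (2 * c) - (c / 2) * u\<^sup>2)"
  proof -
    have "0 \<le> (M + 1 - c * \<bar>u\<bar>)\<^sup>2 / (2 * c)"
      using assms by simp
    also have "\<dots> = (M + 1)\<^sup>2 / (2 * c) - (M + 1) * \<bar>u\<bar> + (c / 2) * u\<^sup>2"
      using assms by (simp add: power2_diff power_mult_distrib field_simps) (simp add: power2_eq_square)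
    finally show ?thesis by (simp add: algebra_simps)
  qed
  also have "\<dots> = fact k * exp ((M + 1)\<^sup>2 / (2 * c)) * exp (- (c / 2) * u\<^sup>2)"
    by (simp add: exp_add [symmetric])
  finally show ?thesis .
qed

lemma integrable_power_gaussian:
  fixes c M :: real
  assumes "c > 0"
  shows "integrable lborel (\<lambda>u::real. \<bar>u\<bar> ^ k * exp (M * \<bar>u\<bar> - c * u\<^sup>2))"
proof (rule Bochner_Integration.integrable_bound)
  show "integrable lborel (\<lambda>u::real. fact k * exp ((M + 1)\<^sup>2 / (2 * c)) * exp (- (c / 2) * u\<^sup>2))"
    using integrable_gaussian [of "c / 2"] assms by simp
  show "AE u::real in lborel. norm (\<bar>u\<bar> ^ k * exp (M * \<bar>u\<bar> - c * u\<^sup>2))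
      \<le> norm (fact k * exp ((M + 1)\<^sup>2 / (2 * c)) * exp (- (c / 2) * u\<^sup>2))"
    using power_exp_le_gaussian [OF assms] by (intro AE_I2) (simp add: abs_mult)
qed simp

lemma tendsto_power_gaussian:
  fixes c M :: real
  assumes "c > 0"
  shows "((\<lambda>u. \<bar>u\<bar> ^ k * exp (M * \<bar>u\<bar> - c * u\<^sup>2)) \<longlongrightarrow> 0) at_infinity"
proof (rule Lim_null_comparison)
  show "\<forall>\<^sub>F u in at_infinity. norm (\<bar>u\<bar> ^ k * exp (M * \<bar>u\<bar> - c * u\<^sup>2))
      \<le> fact k * exp ((M + 1)\<^sup>2 / (2 * c)) * exp (- (c / 2) * u\<^sup>2)"
    using power_exp_le_gaussian [OF assms] by (intro always_eventually) (simp add: abs_mult)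
  have "filterlim (\<lambda>u::real. (c / 2) * (norm u * norm u)) at_top at_infinity"
    using assms
    by (intro filterlim_tendsto_pos_mult_at_top [OF tendsto_const] filterlim_at_top_mult_at_top
        filterlim_norm_at_top) auto
  then have "((\<lambda>u. exp (- ((c / 2) * (norm u * norm u)))) \<longlongrightarrow> 0) (at_infinity :: real filter)"
    by (intro filterlim_compose [OF exp_at_bot]) (simp add: filterlim_uminus_at_bot)
  then have "((\<lambda>u. exp (- (c / 2) * u\<^sup>2)) \<longlongrightarrow> 0) (at_infinity :: real filter)"
    by (simp add: power2_eq_square)
  then show "((\<lambda>u. fact k * exp ((M + 1)\<^sup>2 / (2 * c)) * exp (- (c / 2) * u\<^sup>2)) \<longlongrightarrow> 0) (at_infinity :: real filter)"
    by (rule tendsto_mult_right_zero)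
qed

section \<open>Differentiation under the integral sign and the fundamental theorem on unbounded
  intervals\<close>

text \<open>Dominated convergence for the difference quotients along an arbitrary null sequence; by
  the mean value inequality they inherit the bound \<open>g\<close> on the derivative. Domination is
  asked only near \<open>x\<close>, because weights such as \<open>exp (s * \<zeta>)\<close> have no
  bound uniform in the parameter.\<close>

lemma has_real_derivative_lebesgue_integral:
  fixes f f' :: "real \<Rightarrow> 'a \<Rightarrow> real"
  assumes "e > 0"
    and f: "\<And>y. \<bar>y - x\<bar> < e \<Longrightarrow> integrable M (f y)"
    and f': "\<And>y u. \<bar>y - x\<bar> < e \<Longrightarrow> u \<in> space M \<Longrightarrow> ((\<lambda>y. f y u) has_real_derivative f' y u) (at y)"
    and meas: "f' x \<in> borel_measurable M"
    and g: "integrable M g"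
    and le: "\<And>y u. \<bar>y - x\<bar> < e \<Longrightarrow> u \<in> space M \<Longrightarrow> \<bar>f' y u\<bar> \<le> g u"
  shows "((\<lambda>y. integral\<^sup>L M (f y)) has_real_derivative integral\<^sup>L M (f' x)) (at x)"
  unfolding DERIV_def tendsto_at_iff_sequentially comp_def
proof safe
  fix h :: "nat \<Rightarrow> real"
  assume h: "\<forall>i. h i \<in> UNIV - {0}" "h \<longlonglongrightarrow> 0"
  \<comment> \<open>Dropping the first \<open>N\<close> terms keeps every point
    \<open>x + h n\<close> where integrability and domination are assumed.\<close>
  from h(2) \<open>e > 0\<close> obtain N where N: "\<And>n. n \<ge> N \<Longrightarrow> \<bar>h n\<bar> < e"
    unfolding lim_sequentially by (auto simp: dist_real_def)
  let ?q = "\<lambda>n u. (f (x + h (n + N)) u - f x u) / h (n + N)"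
  have int: "integrable M (f x)" "\<And>n. integrable M (f (x + h (n + N)))"
    using N \<open>e > 0\<close> by (auto intro!: f)
  have "(\<lambda>n. integral\<^sup>L M (?q n)) \<longlonglongrightarrow> integral\<^sup>L M (f' x)"
  proof (rule integral_dominated_convergence [where w = g])
    show "?q n \<in> borel_measurable M" for n
      using int by (intro borel_measurable_divide borel_measurable_diff) auto
    show "AE u in M. (\<lambda>n. ?q n u) \<longlonglongrightarrow> f' x u"
    proof (intro AE_I2)
      fix u assume "u \<in> space M"
      then have "(\<lambda>h. (f (x + h) u - f x u) / h) \<midarrow>0\<rightarrow> f' x u"
        using f' [of x u] \<open>e > 0\<close> by (simp add: DERIV_def)
      moreover have "(\<lambda>n. h (n + N)) \<longlonglongrightarrow> 0"
        using h(2) by (rule LIMSEQ_ignore_initial_segment)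
      ultimately show "(\<lambda>n. ?q n u) \<longlonglongrightarrow> f' x u"
        using h(1) by (auto simp: tendsto_at_iff_sequentially comp_def)
    qed
    show "AE u in M. norm (?q n u) \<le> g u" for n
    proof (intro AE_I2)
      fix u assume u: "u \<in> space M"
      have hn: "\<bar>h (n + N)\<bar> < e" "h (n + N) \<noteq> 0"
        using N h(1) by auto
      have "norm (f (x + h (n + N)) u - f x u) \<le> g u * norm (x + h (n + N) - x)"
      proof (rule field_differentiable_bound [where S = "ball x e" and f' = "\<lambda>y. f' y u"])
        show "((\<lambda>y. f y u) has_field_derivative f' y u) (at y within ball x e)" if "y \<in> ball x e" for y
          using that u
          by (intro has_field_derivative_at_within [OF f']) (auto simp: dist_real_def)
        show "norm (f' y u) \<le> g u" if "y \<in> ball x e" for y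
          using that u le [of y u] by (auto simp: dist_real_def)
      qed (use hn \<open>e > 0\<close> in \<open>auto simp: dist_real_def\<close>)
      with hn show "norm (?q n u) \<le> g u"
        by (simp add: divide_le_eq abs_divide)
    qed
  qed (use meas g in auto)
  also have "(\<lambda>n. integral\<^sup>L M (?q n)) =
      (\<lambda>n. (integral\<^sup>L M (f (x + h (n + N))) - integral\<^sup>L M (f x)) / h (n + N))"
    using int by simp
  finally show "(\<lambda>n. (integral\<^sup>L M (f (x + h n)) - integral\<^sup>L M (f x)) / h n)
      \<longlonglongrightarrow> integral\<^sup>L M (f' x)"
    by (rule LIMSEQ_offset)
qed

lemma lborel_integral_FTC:
  fixes F f :: "real \<Rightarrow> real"
  assumes F: "\<And>x. (F has_real_derivative f x) (at x)"
    and f: "continuous_on UNIV f" "integrable lborel f"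
    and A: "(F \<longlongrightarrow> A) at_bot" and B: "(F \<longlongrightarrow> B) at_top"
  shows "integral\<^sup>L lborel f = B - A"
proof -
  have "(LBINT x=-\<infinity>..\<infinity>. f x) = B - A"
  proof (rule interval_integral_FTC_integrable)
    show "(F has_vector_derivative f x) (at x)" for x
      using F [of x] by (simp add: has_real_derivative_iff_has_vector_derivative)
    show "isCont f x" for x
      using f(1) by (simp add: continuous_on_eq_continuous_at)
    show "((F \<circ> real_of_ereal) \<longlongrightarrow> A) (at_right (-\<infinity>))"
      "((F \<circ> real_of_ereal) \<longlongrightarrow> B) (at_left \<infinity>)"
      using A B by (simp_all add: ereal_tendsto_simps)
  qed (use f(2) in \<open>simp_all add: set_integrable_def\<close>)
  then show ?thesis
    by (simp add: interval_lebesgue_integral_def set_lebesgue_integral_def)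
qed

lemma set_integral_FTC_Ioi:
  fixes F f :: "real \<Rightarrow> real"
  assumes F: "\<And>x. x \<ge> a \<Longrightarrow> (F has_real_derivative f x) (at x)"
    and f: "continuous_on UNIV f" "set_integrable lborel {a<..} f"
    and B: "(F \<longlongrightarrow> B) at_top"
  shows "(LBINT x:{a<..}. f x) = B - F a"
proof -
  have "(LBINT x=a..\<infinity>. f x) = B - F a"
  proof (rule interval_integral_FTC_integrable)
    show "(F has_vector_derivative f x) (at x)" if "ereal a < ereal x" for x
      using F [of x] that by (simp add: has_real_derivative_iff_has_vector_derivative)
    show "isCont f x" for x
      using f(1) by (simp add: continuous_on_eq_continuous_at)
    \<comment> \<open>Differentiability at the endpoint itself identifies the one-sided limit there
      with \<open>F a\<close>.\<close>
    have "isCont F a"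
      using F [of a] by (simp add: DERIV_isCont)
    then show "((F \<circ> real_of_ereal) \<longlongrightarrow> F a) (at_right (ereal a))"
      by (simp add: ereal_tendsto_simps isCont_def filterlim_at_split)
    show "((F \<circ> real_of_ereal) \<longlongrightarrow> B) (at_left \<infinity>)"
      using B by (simp add: ereal_tendsto_simps)
  qed (use f(2) in simp_all)
  then show ?thesis
    by (simp add: interval_lebesgue_integral_def)
qed

lemma set_integral_FTC_Iio:
  fixes F f :: "real \<Rightarrow> real"
  assumes F: "\<And>x. x \<le> b \<Longrightarrow> (F has_real_derivative f x) (at x)"
    and f: "continuous_on UNIV f" "set_integrable lborel {..<b} f"
    and A: "(F \<longlongrightarrow> A) at_bot"
  shows "(LBINT x:{..<b}. f x) = F b - A"
proof -
  have "(LBINT x=-\<infinity>..b. f x) = F b - A"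
  proof (rule interval_integral_FTC_integrable)
    show "(F has_vector_derivative f x) (at x)" if "ereal x < ereal b" for x
      using F [of x] that by (simp add: has_real_derivative_iff_has_vector_derivative)
    show "isCont f x" for x
      using f(1) by (simp add: continuous_on_eq_continuous_at)
    have "isCont F b"
      using F [of b] by (simp add: DERIV_isCont)
    then show "((F \<circ> real_of_ereal) \<longlongrightarrow> F b) (at_left (ereal b))"
      by (simp add: ereal_tendsto_simps isCont_def filterlim_at_split)
    show "((F \<circ> real_of_ereal) \<longlongrightarrow> A) (at_right (-\<infinity>))"
      using A by (simp add: ereal_tendsto_simps)
  qed (use f(2) in simp_all)
  then show ?thesis
    by (simp add: interval_lebesgue_integral_def)
qed

section \<open>The Airy function on a shifted contour\<close>

text \<open>The phase \<open>\<theta>\<close> keeps the family closed under differentiation in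
  \<open>\<zeta>\<close>: each derivative brings down a factor \<open>u\<close> and turns the cosine
  by \<open>pi / 2\<close>.\<close>

definition cubic_wave :: "nat \<Rightarrow> real \<Rightarrow> real \<Rightarrow> real \<Rightarrow> real \<Rightarrow> real" where
  "cubic_wave k \<theta> c \<zeta> u = u ^ k * exp (- c * u\<^sup>2) * cos (u ^ 3 / 3 + \<zeta> * u + \<theta>)"

text \<open>Since the sine part is odd, \<open>airy_osc 0 0 c\<close> is \<open>2 * pi\<close> times
  the inverse Fourier transform of \<open>exp (i u^3 / 3 - c u^2)\<close>.\<close>

definition airy_osc :: "nat \<Rightarrow> real \<Rightarrow> real \<Rightarrow> real \<Rightarrow> real" where
  "airy_osc k \<theta> c \<zeta> = (LBINT u. cubic_wave k \<theta> c \<zeta> u)"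

lemma cubic_wave_measurable [measurable]: "cubic_wave k \<theta> c \<zeta> \<in> borel_measurable borel"
  unfolding cubic_wave_def by measurable

lemma abs_cubic_wave_le: "\<bar>cubic_wave k \<theta> c \<zeta> u\<bar> \<le> \<bar>u\<bar> ^ k * exp (0 * \<bar>u\<bar> - c * u\<^sup>2)"
  unfolding cubic_wave_def by (simp add: abs_mult power_abs mult_left_le)

lemma integrable_cubic_wave:
  assumes "c > 0"
  shows "integrable lborel (cubic_wave k \<theta> c \<zeta>)"
proof (rule Bochner_Integration.integrable_bound [OF integrable_power_gaussian [OF assms, of k 0]])
  show "AE u in lborel. norm (cubic_wave k \<theta> c \<zeta> u) \<le> norm (\<bar>u\<bar> ^ k * exp (0 * \<bar>u\<bar> - c * u\<^sup>2))"
    using abs_cubic_wave_le [of k \<theta> c \<zeta>] by (intro AE_I2) (simp add: abs_mult)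
qed simp

lemma abs_airy_osc_le:
  assumes "c > 0"
  shows "\<bar>airy_osc k \<theta> c \<zeta>\<bar> \<le> (LBINT u. \<bar>u\<bar> ^ k * exp (0 * \<bar>u\<bar> - c * u\<^sup>2))"
proof -
  have "norm (airy_osc k \<theta> c \<zeta>) \<le> (LBINT u. \<bar>u\<bar> ^ k * exp (0 * \<bar>u\<bar> - c * u\<^sup>2))"
    unfolding airy_osc_def
  proof (rule Bochner_Integration.integral_norm_bound_integral)
    show "norm (cubic_wave k \<theta> c \<zeta> u) \<le> \<bar>u\<bar> ^ k * exp (0 * \<bar>u\<bar> - c * u\<^sup>2)" for u
      using abs_cubic_wave_le by simp
  qed (rule integrable_cubic_wave integrable_power_gaussian assms)+
  then show ?thesis by simp
qed

lemma DERIV_airy_osc: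
  assumes "c > 0"
  shows "(airy_osc k \<theta> c has_real_derivative airy_osc (Suc k) (\<theta> + pi / 2) c \<zeta>) (at \<zeta>)"
  unfolding airy_osc_def
proof (rule has_real_derivative_lebesgue_integral [where e = 1 and
      f = "cubic_wave k \<theta> c" and f' = "cubic_wave (Suc k) (\<theta> + pi / 2) c"])
  show "((\<lambda>y. cubic_wave k \<theta> c y u) has_real_derivative cubic_wave (Suc k) (\<theta> + pi / 2) c y u) (at y)" for y u
  proof -
    have "cos (u ^ 3 / 3 + y * u + (\<theta> + pi / 2)) = - sin (u ^ 3 / 3 + y * u + \<theta>)"
      using cos_add [of "u ^ 3 / 3 + y * u + \<theta>" "pi / 2"] by (simp add: add.assoc)
    then show ?thesis
      unfolding cubic_wave_def by (auto intro!: derivative_eq_intros)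
  qed
  show "\<bar>cubic_wave (Suc k) (\<theta> + pi / 2) c y u\<bar> \<le> \<bar>u\<bar> ^ Suc k * exp (0 * \<bar>u\<bar> - c * u\<^sup>2)" for y u
    by (rule abs_cubic_wave_le)
qed (rule zero_less_one integrable_cubic_wave [OF assms] integrable_power_gaussian [OF assms] | simp)+

text \<open>The total derivative in \<open>u\<close> of
  \<open>exp (- c * u\<^sup>2) * sin (u ^ 3 / 3 + \<zeta> * u)\<close> integrates to 0. The phases
  \<open>pi / 2\<close> and \<open>pi\<close> make the three terms the second and first derivative
  in \<open>\<zeta>\<close> and the function itself.\<close>

lemma airy_osc_ode:
  assumes "c > 0"
  shows "airy_osc 2 pi c \<zeta> = 2 * c * airy_osc 1 (pi / 2) c \<zeta> + \<zeta> * airy_osc 0 0 c \<zeta>"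
proof -
  let ?F = "\<lambda>u. exp (- c * u\<^sup>2) * sin (u ^ 3 / 3 + \<zeta> * u)"
  let ?f = "\<lambda>u. 2 * c * cubic_wave 1 (pi / 2) c \<zeta> u + \<zeta> * cubic_wave 0 0 c \<zeta> u - cubic_wave 2 pi c \<zeta> u"
  have lim: "(?F \<longlongrightarrow> 0) at_infinity"
  proof (rule Lim_null_comparison)
    show "((\<lambda>u. \<bar>u\<bar> ^ 0 * exp (0 * \<bar>u\<bar> - c * u\<^sup>2)) \<longlongrightarrow> 0) at_infinity"
      by (rule tendsto_power_gaussian [OF assms])
  qed (auto simp: abs_mult mult_left_le)
  have "integral\<^sup>L lborel ?f = 0 - 0"
  proof (rule lborel_integral_FTC [where F = ?F])
    show "(?F has_real_derivative ?f u) (at u)" for u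
      unfolding cubic_wave_def
      by (auto intro!: derivative_eq_intros simp: cos_add sin_add algebra_simps power2_eq_square)
    show "continuous_on UNIV ?f"
      unfolding cubic_wave_def by (intro continuous_intros) auto
    show "integrable lborel ?f"
      using assms
      by (intro Bochner_Integration.integrable_add Bochner_Integration.integrable_diff
          integrable_mult_right integrable_cubic_wave)
    show "(?F \<longlongrightarrow> 0) at_bot" "(?F \<longlongrightarrow> 0) at_top"
      using lim by (auto intro: tendsto_mono at_bot_le_at_infinity at_top_le_at_infinity)
  qed
  moreover have "integral\<^sup>L lborel ?f =
      2 * c * airy_osc 1 (pi / 2) c \<zeta> + \<zeta> * airy_osc 0 0 c \<zeta> - airy_osc 2 pi c \<zeta>"
    unfolding airy_osc_def using assms by (simp add: integrable_cubic_wave)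
  ultimately show ?thesis by simp
qed

section \<open>Moving the contour of the Airy integral\<close>

text \<open>At height \<open>c\<close> the cube contributes the damping
  \<open>- c * u\<^sup>2\<close> and lowers the frequency from \<open>x\<close> to
  \<open>x - c\<^sup>2\<close>. The norm is needed on the vertical edge of the contour.\<close>

lemma cubic_wave_as_exp:
  fixes x c u :: real and z :: complex
  defines "z \<equiv> Complex u c"
  shows "Re (exp (\<i> * (z ^ 3 / 3 + x * z))) = exp (c ^ 3 / 3 - x * c) * cubic_wave 0 0 c (x - c\<^sup>2) u"
    and "norm (exp (\<i> * (z ^ 3 / 3 + x * z))) = exp (c ^ 3 / 3 - x * c) * exp (- c * u\<^sup>2)"
proof -
  have "\<i> * (z ^ 3 / 3 + x * z) = Complex (c ^ 3 / 3 - x * c - c * u\<^sup>2) (u ^ 3 / 3 + (x - c\<^sup>2) * u)"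
    by (simp add: z_def complex_eq_iff power3_eq_cube power2_eq_square field_simps)
  then show "Re (exp (\<i> * (z ^ 3 / 3 + x * z))) = exp (c ^ 3 / 3 - x * c) * cubic_wave 0 0 c (x - c\<^sup>2) u"
    and "norm (exp (\<i> * (z ^ 3 / 3 + x * z))) = exp (c ^ 3 / 3 - x * c) * exp (- c * u\<^sup>2)"
    by (simp_all add: Re_exp cubic_wave_def mult.assoc [symmetric] flip: exp_add)
qed

lemma set_integral_cubic_wave_Ici:
  assumes "c > 0"
  shows "(LBINT u:{0..}. cubic_wave 0 0 c \<zeta> u) = airy_osc 0 0 c \<zeta> / 2"
proof -
  have even: "cubic_wave 0 0 c \<zeta> (- u) = cubic_wave 0 0 c \<zeta> u" for u
    using cos_minus [of "u ^ 3 / 3 + \<zeta> * u"] by (simp add: cubic_wave_def)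
  have "set_integrable lborel {0..} (cubic_wave 0 0 c \<zeta>)"
    unfolding set_integrable_def by (intro integrable_mult_indicator integrable_cubic_wave assms) simp
  then have "has_bochner_integral lborel (\<lambda>u. indicator {0..} u *\<^sub>R cubic_wave 0 0 c \<zeta> u)
      (LBINT u:{0..}. cubic_wave 0 0 c \<zeta> u)"
    unfolding set_integrable_def set_lebesgue_integral_def by (rule has_bochner_integral_integrable)
  from has_bochner_integral_even_function [OF this even] show ?thesis
    by (simp add: airy_osc_def has_bochner_integral_iff)
qed

text \<open>The contour argument runs on the rectangle with corners 0, \<open>R\<close>,
  \<open>R + i c\<close>, \<open>i c\<close>. A global primitive \<open>\<Phi>\<close> turns each
  edge integral into a difference of values; the left edge contributes nothing to the real part and
  the right edge is of order \<open>1 / R\<^sup>2\<close>.\<close>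

lemma Airy_Ai_eq_airy_osc:
  assumes "c > 0"
  shows "Airy_Ai x = exp (c ^ 3 / 3 - x * c) / (2 * pi) * airy_osc 0 0 c (x - c\<^sup>2)"
proof -
  define f where "f = (\<lambda>z::complex. exp (\<i> * (z ^ 3 / 3 + x * z)))"
  have "f holomorphic_on UNIV"
    unfolding f_def by (intro holomorphic_intros) auto
  then obtain \<Phi> where \<Phi>: "\<And>z. (\<Phi> has_field_derivative f z) (at z)"
    using holomorphic_convex_primitive' [of UNIV f] by auto
  have hor: "((\<lambda>u. Re (\<Phi> (Complex u y))) has_real_derivative Re (f (Complex u y))) (at u)" for u y
  proof -
    have "((\<lambda>u. Complex u y) has_vector_derivative 1) (at u)"
      unfolding Complex_eq by (auto intro!: derivative_eq_intros)
    from field_vector_diff_chain_at [OF this \<Phi>] show ?thesis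
      by (auto simp: comp_def has_real_derivative_iff_has_vector_derivative dest!: bounded_linear.has_vector_derivative [OF bounded_linear_Re])
  qed
  have ver: "((\<lambda>y. Re (\<Phi> (Complex u y))) has_real_derivative - Im (f (Complex u y))) (at y)" for u y
  proof -
    have "((\<lambda>y. Complex u y) has_vector_derivative \<i>) (at y)"
      unfolding Complex_eq by (auto intro!: derivative_eq_intros)
    from field_vector_diff_chain_at [OF this \<Phi>] show ?thesis
      by (auto simp: comp_def has_real_derivative_iff_has_vector_derivative dest!: bounded_linear.has_vector_derivative [OF bounded_linear_Re])
  qed
  have int: "(LBINT u:{0..R}. Re (f (Complex u y))) = Re (\<Phi> (Complex R y)) - Re (\<Phi> (Complex 0 y))"
    if "R \<ge> 0" for R y
    unfolding set_lebesgue_integral_def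
  proof (rule integral_FTC_Icc)
    show "((\<lambda>u. Re (\<Phi> (Complex u y))) has_vector_derivative Re (f (Complex u y))) (at u within {0..R})" for u
      using hor [of y u] by (simp add: has_real_derivative_iff_has_vector_derivative has_vector_derivative_at_within)
    show "continuous_on {0..R} (\<lambda>u. Re (f (Complex u y)))"
      unfolding f_def Complex_eq by (intro continuous_intros) auto
  qed fact
  \<comment> \<open>The exponent is real on the imaginary axis, so \<open>f\<close> is real there
    and the real part of \<open>\<Phi>\<close> stays constant along the left edge.\<close>
  have "Re (\<Phi> (Complex 0 c)) = Re (\<Phi> (Complex 0 0))"
  proof (rule DERIV_isconst_all [where f = "\<lambda>y. Re (\<Phi> (Complex 0 y))"])
    have "Im (f (Complex 0 y)) = 0" for y
      by (simp add: f_def Im_exp power3_eq_cube Complex_eq)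
    then show "\<forall>y. ((\<lambda>y. Re (\<Phi> (Complex 0 y))) has_real_derivative 0) (at y)"
      using ver [of 0] by simp
  qed
  then have diff: "(LBINT u:{0..R}. Re (f (Complex u c))) - (LBINT u:{0..R}. Re (f (Complex u 0)))
      = Re (\<Phi> (Complex R c)) - Re (\<Phi> (Complex R 0))" if "R \<ge> 0" for R
    using int [OF that] by simp
  \<comment> \<open>Bounds \<open>exp (y ^ 3 / 3 - x * y)\<close> for all heights \<open>y\<close>
    between 0 and \<open>c\<close>.\<close>
  define K where "K = exp (c ^ 3 / 3 + \<bar>x\<bar> * c)"
  have edge: "\<bar>Re (\<Phi> (Complex R c)) - Re (\<Phi> (Complex R 0))\<bar> \<le> K / R\<^sup>2" if "R > 0" for R
  proof -
    \<comment> \<open>An antiderivative of the bound \<open>K * exp (- (R\<^sup>2 * y))\<close> on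
      the edge. Both \<open>?\<phi> - Re \<Phi>\<close> and \<open>?\<phi> + Re \<Phi>\<close> are
      then nondecreasing in \<open>y\<close>, which bounds the change of \<open>Re \<Phi>\<close> by
      that of \<open>?\<phi>\<close>.\<close>
    let ?\<phi> = "\<lambda>y. - (K / R\<^sup>2) * exp (- (R\<^sup>2 * y))"
    have \<phi>: "(?\<phi> has_real_derivative K * exp (- (R\<^sup>2 * y))) (at y)" for y
      using that by (auto intro!: derivative_eq_intros simp: power2_eq_square power4_eq_xxxx)
    have le: "\<bar>Im (f (Complex R y))\<bar> \<le> K * exp (- (R\<^sup>2 * y))" if "0 \<le> y" "y \<le> c" for y
    proof -
      have "\<bar>Im (f (Complex R y))\<bar> \<le> norm (f (Complex R y))"
        by (rule abs_Im_le_cmod)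
      also have "\<dots> = exp (y ^ 3 / 3 - x * y) * exp (- (R\<^sup>2 * y))"
        unfolding f_def by (subst cubic_wave_as_exp(2)) (simp add: mult.commute)
      also have "exp (y ^ 3 / 3 - x * y) \<le> K"
      proof -
        have "- x * y \<le> \<bar>x\<bar> * c"
          using that by (intro mult_mono) auto
        moreover have "y ^ 3 \<le> c ^ 3"
          using that by (intro power_mono)
        ultimately show ?thesis
          by (simp add: K_def)
      qed
      finally show ?thesis
        by simp
    qed
    have "?\<phi> 0 - Re (\<Phi> (Complex R 0)) \<le> ?\<phi> c - Re (\<Phi> (Complex R c))"
    proof (rule DERIV_nonneg_imp_nondecreasing [where f = "\<lambda>y. ?\<phi> y - Re (\<Phi> (Complex R y))"])
      fix y assume "0 \<le> y" "y \<le> c"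
      then have "0 \<le> K * exp (- (R\<^sup>2 * y)) - - Im (f (Complex R y))"
        using le [of y] by linarith
      moreover have "((\<lambda>y. ?\<phi> y - Re (\<Phi> (Complex R y))) has_real_derivative
          K * exp (- (R\<^sup>2 * y)) - - Im (f (Complex R y))) (at y)"
        by (rule DERIV_diff [OF \<phi> ver])
      ultimately show "\<exists>D. ((\<lambda>y. ?\<phi> y - Re (\<Phi> (Complex R y))) has_real_derivative D) (at y) \<and> 0 \<le> D"
        by blast
    qed (use assms in simp)
    moreover have "?\<phi> 0 + Re (\<Phi> (Complex R 0)) \<le> ?\<phi> c + Re (\<Phi> (Complex R c))"
    proof (rule DERIV_nonneg_imp_nondecreasing [where f = "\<lambda>y. ?\<phi> y + Re (\<Phi> (Complex R y))"])
      fix y assume "0 \<le> y" "y \<le> c"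
      then have "0 \<le> K * exp (- (R\<^sup>2 * y)) + - Im (f (Complex R y))"
        using le [of y] by linarith
      moreover have "((\<lambda>y. ?\<phi> y + Re (\<Phi> (Complex R y))) has_real_derivative
          K * exp (- (R\<^sup>2 * y)) + - Im (f (Complex R y))) (at y)"
        by (rule DERIV_add [OF \<phi> ver])
      ultimately show "\<exists>D. ((\<lambda>y. ?\<phi> y + Re (\<Phi> (Complex R y))) has_real_derivative D) (at y) \<and> 0 \<le> D"
        by blast
    qed (use assms in simp)
    moreover have "?\<phi> c \<le> 0" "?\<phi> 0 = - (K / R\<^sup>2)"
      by (simp_all add: K_def)
    ultimately show ?thesis
      by linarith
  qed
  have edge_lim: "((\<lambda>R. (LBINT u:{0..R}. Re (f (Complex u c))) - (LBINT u:{0..R}. Re (f (Complex u 0)))) \<longlongrightarrow> 0) at_top"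
  proof (rule Lim_null_comparison)
    show "\<forall>\<^sub>F R in at_top. norm ((LBINT u:{0..R}. Re (f (Complex u c))) - (LBINT u:{0..R}. Re (f (Complex u 0)))) \<le> K / R\<^sup>2"
      using eventually_gt_at_top [of 0] by eventually_elim (use diff edge in auto)
    show "((\<lambda>R. K / R\<^sup>2) \<longlongrightarrow> 0) at_top"
      by (intro tendsto_divide_0 [OF tendsto_const] filterlim_at_top_imp_at_infinity filterlim_pow_at_top
          filterlim_ident) simp
  qed
  have upper: "Re (f (Complex u c)) = exp (c ^ 3 / 3 - x * c) * cubic_wave 0 0 c (x - c\<^sup>2) u" for u
    unfolding f_def by (rule cubic_wave_as_exp(1))
  \<comment> \<open>At height 0 the damping disappears and the integrand defining
    \<open>Airy_Ai\<close> is left.\<close>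
  have lower: "Re (f (Complex u 0)) = cos (u ^ 3 / 3 + x * u)" for u
    unfolding f_def by (subst cubic_wave_as_exp(1)) (simp add: cubic_wave_def)
  have "((\<lambda>R. LBINT u:{0..R}. exp (c ^ 3 / 3 - x * c) * cubic_wave 0 0 c (x - c\<^sup>2) u)
      \<longlongrightarrow> (LBINT u:{0..}. exp (c ^ 3 / 3 - x * c) * cubic_wave 0 0 c (x - c\<^sup>2) u)) at_top"
  proof (rule tendsto_set_lebesgue_integral_at_top)
    show "set_integrable lborel {0..} (\<lambda>u. exp (c ^ 3 / 3 - x * c) * cubic_wave 0 0 c (x - c\<^sup>2) u)"
      using integrable_cubic_wave [OF assms] unfolding set_integrable_def
      by (intro integrable_mult_indicator integrable_mult_right) auto
  qed simp
  from tendsto_diff [OF this edge_lim [unfolded upper lower]]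
  have "((\<lambda>R. LBINT u:{0..R}. cos (u ^ 3 / 3 + x * u)) \<longlongrightarrow>
      exp (c ^ 3 / 3 - x * c) * (airy_osc 0 0 c (x - c\<^sup>2) / 2)) at_top"
    by (simp add: set_integral_cubic_wave_Ici [OF assms])
  \<comment> \<open>\<open>Lim\<close> is a definite description, so its value is known only once
    convergence has been shown.\<close>
  then have lim: "Lim at_top (\<lambda>R. LBINT u:{0..R}. cos (u ^ 3 / 3 + x * u)) =
      exp (c ^ 3 / 3 - x * c) * (airy_osc 0 0 c (x - c\<^sup>2) / 2)"
    by (intro tendsto_Lim) simp_all
  show ?thesis
    unfolding Airy_Ai_def lim by simp
qed

text \<open>The height \<open>b\<^sup>2 / 2\<close> has square \<open>b ^ 4 / 4\<close>, which
  undoes the shift of the argument; the prefactor of \<open>Ai_deformed\<close> cancels the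
  exponential produced by the contour shift.\<close>

lemma Ai_deformed_eq_airy_osc:
  assumes "b > 0"
  shows "Ai_deformed b \<zeta> = airy_osc 0 0 (b\<^sup>2 / 2) \<zeta> / (2 * pi)"
proof -
  have "b\<^sup>2 / 2 > 0"
    using assms by simp
  from Airy_Ai_eq_airy_osc [OF this, of "\<zeta> + b ^ 4 / 4"]
  have "Ai_deformed b \<zeta> = exp (b\<^sup>2 * \<zeta> / 2 + b ^ 6 / 12) *
      exp ((b\<^sup>2 / 2) ^ 3 / 3 - (\<zeta> + b ^ 4 / 4) * (b\<^sup>2 / 2)) * (airy_osc 0 0 (b\<^sup>2 / 2) \<zeta> / (2 * pi))"
    by (simp add: Ai_deformed_def power_divide)
  also have "exp (b\<^sup>2 * \<zeta> / 2 + b ^ 6 / 12) *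
      exp ((b\<^sup>2 / 2) ^ 3 / 3 - (\<zeta> + b ^ 4 / 4) * (b\<^sup>2 / 2)) = 1"
    by (simp add: exp_add [symmetric] power_divide) (simp add: field_simps flip: power_add)
  finally show ?thesis
    by simp
qed

section \<open>Exponential decay and integrability\<close>

lemma integrable_exp_neg_abs:
  fixes a :: real
  assumes "a > 0"
  shows "integrable lborel (\<lambda>x::real. exp (- a * \<bar>x\<bar>))"
proof -
  have "set_integrable lebesgue {0..} (\<lambda>x. exp (- a * x))"
    using integrable_on_exp_minus_to_infinity [OF assms, of 0]
    by (intro nonnegative_absolutely_integrable_1) auto
  then have "integrable lborel (\<lambda>x. indicator {0..} x *\<^sub>R exp (- a * x))"
    unfolding set_integrable_def by (subst (asm) integrable_completion) auto
  also have "(\<lambda>x. indicator {0..} x *\<^sub>R exp (- a * x)) = (\<lambda>x. indicator {0..} x *\<^sub>R exp (- a * \<bar>x\<bar>))"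
    by (auto simp: indicator_def)
  finally show ?thesis
    using has_bochner_integral_even_function [OF has_bochner_integral_integrable, of "\<lambda>x. exp (- a * \<bar>x\<bar>)"]
    by (simp add: has_bochner_integral_iff)
qed

text \<open>Heights \<open>c\<close> and \<open>d\<close> represent the same value
  \<open>Airy_Ai (\<zeta> + c\<^sup>2)\<close>; comparing the two representations gives the
  factor.\<close>

lemma airy_osc_shift:
  assumes "c > 0" "d > 0"
  shows "airy_osc 0 0 c \<zeta> = exp (d ^ 3 / 3 - c ^ 3 / 3 + (c - d) * (\<zeta> + c\<^sup>2)) * airy_osc 0 0 d (\<zeta> + c\<^sup>2 - d\<^sup>2)"
proof -
  have "exp (c ^ 3 / 3 - (\<zeta> + c\<^sup>2) * c) * airy_osc 0 0 c \<zeta> =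
      exp (d ^ 3 / 3 - (\<zeta> + c\<^sup>2) * d) * airy_osc 0 0 d (\<zeta> + c\<^sup>2 - d\<^sup>2)"
    using Airy_Ai_eq_airy_osc [OF assms(1), of "\<zeta> + c\<^sup>2"] Airy_Ai_eq_airy_osc [OF assms(2), of "\<zeta> + c\<^sup>2"]
    by simp
  then have "airy_osc 0 0 c \<zeta> = exp (d ^ 3 / 3 - (\<zeta> + c\<^sup>2) * d) / exp (c ^ 3 / 3 - (\<zeta> + c\<^sup>2) * c)
      * airy_osc 0 0 d (\<zeta> + c\<^sup>2 - d\<^sup>2)"
    by (simp add: field_simps)
  also have "exp (d ^ 3 / 3 - (\<zeta> + c\<^sup>2) * d) / exp (c ^ 3 / 3 - (\<zeta> + c\<^sup>2) * c) =
      exp (d ^ 3 / 3 - c ^ 3 / 3 + (c - d) * (\<zeta> + c\<^sup>2))"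
    by (simp add: exp_diff [symmetric] algebra_simps)
  finally show ?thesis .
qed

text \<open>Obtained by differentiating \<open>airy_osc_shift\<close> in \<open>\<zeta>\<close>, so
  the derivative carries the same exponential factor.\<close>

lemma airy_osc_1_shift:
  assumes "c > 0" "d > 0"
  shows "airy_osc 1 (pi / 2) c \<zeta> = exp (d ^ 3 / 3 - c ^ 3 / 3 + (c - d) * (\<zeta> + c\<^sup>2)) *
    ((c - d) * airy_osc 0 0 d (\<zeta> + c\<^sup>2 - d\<^sup>2) + airy_osc 1 (pi / 2) d (\<zeta> + c\<^sup>2 - d\<^sup>2))"
proof -
  let ?e = "\<lambda>\<zeta>. exp (d ^ 3 / 3 - c ^ 3 / 3 + (c - d) * (\<zeta> + c\<^sup>2))"
  have "((\<lambda>\<zeta>. airy_osc 0 0 d (\<zeta> + c\<^sup>2 - d\<^sup>2)) has_real_derivative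
      airy_osc 1 (pi / 2) d (\<zeta> + c\<^sup>2 - d\<^sup>2) * 1) (at \<zeta>)"
    using DERIV_airy_osc [OF assms(2), of 0 0]
    by (intro DERIV_chain2 [where f = "airy_osc 0 0 d"]) (auto intro!: derivative_eq_intros)
  moreover have "(?e has_real_derivative (c - d) * ?e \<zeta>) (at \<zeta>)"
    by (auto intro!: derivative_eq_intros)
  ultimately have "((\<lambda>\<zeta>. ?e \<zeta> * airy_osc 0 0 d (\<zeta> + c\<^sup>2 - d\<^sup>2)) has_real_derivative
      ?e \<zeta> * ((c - d) * airy_osc 0 0 d (\<zeta> + c\<^sup>2 - d\<^sup>2) + airy_osc 1 (pi / 2) d (\<zeta> + c\<^sup>2 - d\<^sup>2))) (at \<zeta>)"
    by (auto intro!: derivative_eq_intros simp: algebra_simps)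
  moreover have "(\<lambda>\<zeta>. ?e \<zeta> * airy_osc 0 0 d (\<zeta> + c\<^sup>2 - d\<^sup>2)) = airy_osc 0 0 c"
    using airy_osc_shift [OF assms] by auto
  ultimately show ?thesis
    using DERIV_airy_osc [OF assms(1), of 0 0 \<zeta>] by (auto dest: DERIV_unique)
qed

text \<open>Since \<open>d\<close> is arbitrary, this yields exponential decay at both ends of the line.\<close>

lemma airy_osc_exp_bound:
  assumes "c > 0" "d > 0"
  obtains K where "\<And>\<zeta>. \<bar>airy_osc 0 0 c \<zeta>\<bar> \<le> K * exp ((c - d) * \<zeta>)"
    and "\<And>\<zeta>. \<bar>airy_osc 1 (pi / 2) c \<zeta>\<bar> \<le> K * exp ((c - d) * \<zeta>)"
proof -
  obtain B where B: "\<And>\<zeta>. \<bar>airy_osc 0 0 d \<zeta>\<bar> \<le> B" "\<And>\<zeta>. \<bar>airy_osc 1 (pi / 2) d \<zeta>\<bar> \<le> B"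
    using abs_airy_osc_le [OF assms(2), of 0 0] abs_airy_osc_le [OF assms(2), of 1 "pi / 2"]
    by (meson max.coboundedI1 max.coboundedI2)
  have "B \<ge> 0"
    using B(1) [of 0] by linarith
  define E where "E = exp (d ^ 3 / 3 - c ^ 3 / 3 + (c - d) * c\<^sup>2)"
  have E: "exp (d ^ 3 / 3 - c ^ 3 / 3 + (c - d) * (\<zeta> + c\<^sup>2)) = E * exp ((c - d) * \<zeta>)" for \<zeta>
    by (simp add: E_def exp_add [symmetric] algebra_simps)
  show thesis
  proof (rule that)
    fix \<zeta>
    \<comment> \<open>One constant has to serve both bounds, so \<open>B\<close> is enlarged to the
      factor that the derivative requires.\<close>
    have "B \<le> (\<bar>c - d\<bar> + 1) * B"
      using \<open>B \<ge> 0\<close> by (simp add: algebra_simps)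
    then have le: "\<bar>airy_osc 0 0 d (\<zeta> + c\<^sup>2 - d\<^sup>2)\<bar> \<le> (\<bar>c - d\<bar> + 1) * B"
      using B(1) order_trans by blast
    show "\<bar>airy_osc 0 0 c \<zeta>\<bar> \<le> ((\<bar>c - d\<bar> + 1) * B * E) * exp ((c - d) * \<zeta>)"
      using mult_left_mono [OF le, of "E * exp ((c - d) * \<zeta>)"]
      by (subst airy_osc_shift [OF assms]) (simp add: E abs_mult E_def mult_ac)
    have "\<bar>(c - d) * airy_osc 0 0 d (\<zeta> + c\<^sup>2 - d\<^sup>2) + airy_osc 1 (pi / 2) d (\<zeta> + c\<^sup>2 - d\<^sup>2)\<bar>
        \<le> \<bar>c - d\<bar> * \<bar>airy_osc 0 0 d (\<zeta> + c\<^sup>2 - d\<^sup>2)\<bar> + \<bar>airy_osc 1 (pi / 2) d (\<zeta> + c\<^sup>2 - d\<^sup>2)\<bar>"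
      by (rule order_trans [OF abs_triangle_ineq]) (simp add: abs_mult)
    also have "\<dots> \<le> \<bar>c - d\<bar> * B + B"
      using B by (intro add_mono mult_left_mono) auto
    finally have le: "\<bar>(c - d) * airy_osc 0 0 d (\<zeta> + c\<^sup>2 - d\<^sup>2) + airy_osc 1 (pi / 2) d (\<zeta> + c\<^sup>2 - d\<^sup>2)\<bar>
        \<le> (\<bar>c - d\<bar> + 1) * B"
      by (simp add: algebra_simps)
    show "\<bar>airy_osc 1 (pi / 2) c \<zeta>\<bar> \<le> ((\<bar>c - d\<bar> + 1) * B * E) * exp ((c - d) * \<zeta>)"
      using mult_left_mono [OF le, of "E * exp ((c - d) * \<zeta>)"]
      by (subst airy_osc_1_shift [OF assms]) (simp add: E abs_mult E_def mult_ac)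
  qed
qed

lemma isCont_airy_osc: "c > 0 \<Longrightarrow> isCont (airy_osc k \<theta> c) \<zeta>"
  by (rule DERIV_isCont [OF DERIV_airy_osc])

lemma borel_measurable_airy_osc [measurable]:
  assumes "c > 0"
  shows "airy_osc k \<theta> c \<in> borel_measurable borel"
  by (intro borel_measurable_continuous_onI continuous_at_imp_continuous_on ballI isCont_airy_osc assms)

text \<open>The height \<open>d = c / 2\<close> gives decay at the left end and
  \<open>d = 3 c / 2\<close> at the right end, both with rate \<open>c / 2\<close>.\<close>

lemma integrable_airy_osc:
  assumes "c > 0"
  shows "integrable lborel (airy_osc 0 0 c)"
proof -
  obtain K where K: "\<And>\<zeta>. \<bar>airy_osc 0 0 c \<zeta>\<bar> \<le> K * exp ((c - c / 2) * \<zeta>)"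
    by (rule airy_osc_exp_bound [of c "c / 2"]) (use assms in auto)
  obtain L where L: "\<And>\<zeta>. \<bar>airy_osc 0 0 c \<zeta>\<bar> \<le> L * exp ((c - (3 / 2) * c) * \<zeta>)"
    by (rule airy_osc_exp_bound [of c "(3 / 2) * c"]) (use assms in auto)
  have "\<bar>airy_osc 0 0 c \<zeta>\<bar> \<le> max K L * exp (- (c / 2) * \<bar>\<zeta>\<bar>)" for \<zeta>
  proof (cases "\<zeta> \<ge> 0")
    case True
    then have "\<bar>airy_osc 0 0 c \<zeta>\<bar> \<le> L * exp (- (c / 2) * \<bar>\<zeta>\<bar>)"
      using L [of \<zeta>] by (simp add: algebra_simps)
    also have "\<dots> \<le> max K L * exp (- (c / 2) * \<bar>\<zeta>\<bar>)"
      by (rule mult_right_mono) auto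
    finally show ?thesis .
  next
    case False
    then have "\<bar>airy_osc 0 0 c \<zeta>\<bar> \<le> K * exp (- (c / 2) * \<bar>\<zeta>\<bar>)"
      using K [of \<zeta>] by (simp add: algebra_simps)
    also have "\<dots> \<le> max K L * exp (- (c / 2) * \<bar>\<zeta>\<bar>)"
      by (rule mult_right_mono) auto
    finally show ?thesis .
  qed
  then have le: "norm (airy_osc 0 0 c \<zeta>) \<le> norm (max K L * exp (- (c / 2) * \<bar>\<zeta>\<bar>))" for \<zeta>
    by (metis abs_ge_self order_trans real_norm_def)
  show ?thesis
  proof (rule Bochner_Integration.integrable_bound)
    show "integrable lborel (\<lambda>\<zeta>::real. max K L * exp (- (c / 2) * \<bar>\<zeta>\<bar>))"
      by (intro integrable_mult_right integrable_exp_neg_abs) (use assms in simp)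
    show "AE \<zeta> in lborel. norm (airy_osc 0 0 c \<zeta>) \<le> norm (max K L * exp (- (c / 2) * \<bar>\<zeta>\<bar>))"
      by (intro AE_I2 le)
  qed (use borel_measurable_airy_osc [OF assms] in simp)
qed

section \<open>The total integral of the deformed Airy function\<close>

text \<open>The real part of the standard normal characteristic function, rotated by the phase
  \<open>\<theta>\<close>.\<close>

lemma integral_std_normal_density_cos:
  "(LBINT x. std_normal_density x * cos (t * x + \<theta>)) = exp (- t\<^sup>2 / 2) * cos \<theta>"
proof -
  interpret real_distribution std_normal_distribution
    by (rule real_dist_normal_dist)
  have int: "integrable std_normal_distribution (\<lambda>x. iexp (t * x) * iexp \<theta>)"
    by (intro integrable_mult_left integrable_iexp) auto
  have "(\<integral>x. cos (t * x + \<theta>) \<partial>std_normal_distribution) = (\<integral>x. Re (iexp (t * x) * iexp \<theta>) \<partial>std_normal_distribution)"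
    by (simp add: Re_exp Im_exp cos_add)
  also have "\<dots> = Re (\<integral>x. iexp (t * x) * iexp \<theta> \<partial>std_normal_distribution)"
    using int by (rule integral_Re)
  also have "\<dots> = Re (char std_normal_distribution t * iexp \<theta>)"
    by (simp add: char_def)
  also have "\<dots> = exp (- t\<^sup>2 / 2) * cos \<theta>"
    by (simp add: char_std_normal_distribution Re_exp)
  finally show ?thesis
    by (simp add: integral_real_density)
qed

lemma integral_scaled_std_normal_density_cos:
  assumes "\<delta> > 0"
  shows "(LBINT x. std_normal_density (\<delta> * x) * cos (\<theta> + x * u)) = exp (- (u / \<delta>)\<^sup>2 / 2) * cos \<theta> / \<delta>"
proof -
  have "(LBINT x. std_normal_density (\<delta> * x) * cos (\<theta> + x * u)) =
      \<bar>1 / \<delta>\<bar> *\<^sub>R (LBINT x. std_normal_density (\<delta> * (0 + 1 / \<delta> * x)) * cos (\<theta> + (0 + 1 / \<delta> * x) * u))"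
    using assms by (intro lborel_integral_real_affine) simp
  also have "\<dots> = (LBINT x. std_normal_density x * cos (u / \<delta> * x + \<theta>)) / \<delta>"
    using assms by (simp add: add.commute mult.commute)
  finally show ?thesis
    by (simp only: integral_std_normal_density_cos)
qed

text \<open>Fourier inversion at the origin, by Gaussian mollification.\<close>

lemma integral_airy_osc:
  assumes "c > 0"
  shows "integral\<^sup>L lborel (airy_osc 0 0 c) = 2 * pi"
proof -
  have density_le: "std_normal_density x \<le> 1" for x
  proof -
    have "1 \<le> sqrt (2 * pi)"
      using pi_gt3 by simp
    then have "1 / sqrt (2 * pi) * exp (- x\<^sup>2 / 2) \<le> 1 * 1"
      by (intro mult_mono) auto
    then show ?thesis
      by (simp add: std_normal_density_def)
  qed
  have mollified: "(LBINT p. std_normal_density (\<delta> * p) * airy_osc 0 0 c p) =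
      sqrt (2 * pi) * (LBINT v. std_normal_density v * (exp (- c * (\<delta> * v)\<^sup>2) * cos ((\<delta> * v) ^ 3 / 3)))"
    if "\<delta> > 0" for \<delta>
  proof -
    let ?f = "\<lambda>p u. std_normal_density (\<delta> * p) * cubic_wave 0 0 c p u"
    let ?g = "\<lambda>p u. std_normal_density (\<delta> * p) * exp (- c * u\<^sup>2)"
    have density: "integrable lborel (\<lambda>p. std_normal_density (\<delta> * p))"
      using lborel_integrable_real_affine [OF integrable_normal_density [of 1 0], of \<delta> 0] that by simp
    \<comment> \<open>The mollifier supplies the decay in \<open>p\<close> that
      \<open>cubic_wave\<close> itself does not have, so Fubini applies.\<close>
    have "integrable (lborel \<Otimes>\<^sub>M lborel) (\<lambda>(p, u). ?g p u)"
      using density integrable_gaussian [OF assms]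
      by (intro lborel_pair.Fubini_integrable) (auto simp: abs_mult)
    then have "integrable (lborel \<Otimes>\<^sub>M lborel) (\<lambda>(p, u). ?f p u)"
    proof (rule Bochner_Integration.integrable_bound)
      show "AE x in lborel \<Otimes>\<^sub>M lborel. norm (case x of (p, u) \<Rightarrow> ?f p u) \<le> norm (case x of (p, u) \<Rightarrow> ?g p u)"
        by (intro AE_I2) (auto simp: cubic_wave_def abs_mult mult_left_le intro!: mult_left_mono)
    qed (simp add: cubic_wave_def)
    then have "(LBINT u. LBINT p. ?f p u) = (LBINT p. LBINT u. ?f p u)"
      by (rule lborel_pair.Fubini_integral)
    also have "\<dots> = (LBINT p. std_normal_density (\<delta> * p) * airy_osc 0 0 c p)"
      by (simp add: airy_osc_def)
    \<comment> \<open>For fixed \<open>u\<close> the inner integral is the Fourier transform of the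
      mollifier, a Gaussian of width \<open>\<delta>\<close> in \<open>u\<close>.\<close>
    also have "(LBINT u. LBINT p. ?f p u) =
        (LBINT u. exp (- c * u\<^sup>2) * (exp (- (u / \<delta>)\<^sup>2 / 2) * cos (u ^ 3 / 3) / \<delta>))"
    proof (rule Bochner_Integration.integral_cong [OF refl])
      fix u
      have "(LBINT p. ?f p u) = (LBINT p. exp (- c * u\<^sup>2) * (std_normal_density (\<delta> * p) * cos (u ^ 3 / 3 + p * u)))"
        by (simp add: cubic_wave_def mult_ac)
      also have "\<dots> = exp (- c * u\<^sup>2) * (exp (- (u / \<delta>)\<^sup>2 / 2) * cos (u ^ 3 / 3) / \<delta>)"
        by (simp only: integral_mult_right_zero integral_scaled_std_normal_density_cos [OF that])
      finally show "(LBINT p. ?f p u) = exp (- c * u\<^sup>2) * (exp (- (u / \<delta>)\<^sup>2 / 2) * cos (u ^ 3 / 3) / \<delta>)" .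
    qed
    \<comment> \<open>Substituting \<open>u = \<delta> * v\<close> frees the Gaussian from
      \<open>\<delta>\<close>, so that a fixed density dominates as \<open>\<delta>\<close> tends to
      0.\<close>
    also have "\<dots> = \<bar>\<delta>\<bar> *\<^sub>R (LBINT v. exp (- c * (\<delta> * v)\<^sup>2) * (exp (- v\<^sup>2 / 2) * cos ((\<delta> * v) ^ 3 / 3) / \<delta>))"
      using that by (subst lborel_integral_real_affine [where c = \<delta> and t = 0]) simp_all
    also have "\<dots> = (LBINT v. \<delta> * (exp (- c * (\<delta> * v)\<^sup>2) * (exp (- v\<^sup>2 / 2) * cos ((\<delta> * v) ^ 3 / 3) / \<delta>)))"
      using that by simp
    also have "\<dots> = (LBINT v. sqrt (2 * pi) * (std_normal_density v * (exp (- c * (\<delta> * v)\<^sup>2) * cos ((\<delta> * v) ^ 3 / 3))))"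
      using that by (intro Bochner_Integration.integral_cong refl) (simp add: std_normal_density_def)
    finally show ?thesis
      by simp
  qed
  let ?\<delta> = "\<lambda>n. inverse (real (Suc n))"
  note lim = LIMSEQ_inverse_real_of_nat
  have "(\<lambda>n. LBINT p. std_normal_density (?\<delta> n * p) * airy_osc 0 0 c p) \<longlonglongrightarrow>
      (LBINT p. std_normal_density 0 * airy_osc 0 0 c p)"
  proof (rule integral_dominated_convergence [where w = "\<lambda>p. \<bar>airy_osc 0 0 c p\<bar>"])
    have "(\<lambda>n. std_normal_density (?\<delta> n * p)) \<longlonglongrightarrow> std_normal_density (0 * p)" for p
      unfolding std_normal_density_def by (intro tendsto_intros lim) simp_all
    then show "AE p in lborel. (\<lambda>n. std_normal_density (?\<delta> n * p) * airy_osc 0 0 c p) \<longlonglongrightarrow>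
        std_normal_density 0 * airy_osc 0 0 c p"
      by (intro AE_I2 tendsto_mult_right) simp
    show "AE p in lborel. norm (std_normal_density (?\<delta> n * p) * airy_osc 0 0 c p) \<le> \<bar>airy_osc 0 0 c p\<bar>" for n
      using density_le by (intro AE_I2) (simp add: abs_mult mult_left_le_one_le)
  qed (use borel_measurable_airy_osc [OF assms] integrable_airy_osc [OF assms] in auto)
  moreover have "(\<lambda>n. sqrt (2 * pi) * (LBINT v. std_normal_density v *
      (exp (- c * (?\<delta> n * v)\<^sup>2) * cos ((?\<delta> n * v) ^ 3 / 3)))) \<longlonglongrightarrow>
      sqrt (2 * pi) * (LBINT v. std_normal_density v * 1)"
  proof (intro tendsto_mult_left integral_dominated_convergence [where w = std_normal_density])
    have "(\<lambda>n. std_normal_density v * (exp (- c * (?\<delta> n * v)\<^sup>2) * cos ((?\<delta> n * v) ^ 3 / 3))) \<longlonglongrightarrow>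
        std_normal_density v * (exp (- c * (0 * v)\<^sup>2) * cos ((0 * v) ^ 3 / 3))" for v
      by (intro tendsto_intros lim) auto
    then show "AE v in lborel. (\<lambda>n. std_normal_density v * (exp (- c * (?\<delta> n * v)\<^sup>2) * cos ((?\<delta> n * v) ^ 3 / 3)))
        \<longlonglongrightarrow> std_normal_density v * 1"
      by simp
    have "exp (- c * (?\<delta> n * v)\<^sup>2) * \<bar>cos ((?\<delta> n * v) ^ 3 / 3)\<bar> \<le> 1 * 1" for n v
      using assms by (intro mult_mono) auto
    then show "AE v in lborel. norm (std_normal_density v *
        (exp (- c * (?\<delta> n * v)\<^sup>2) * cos ((?\<delta> n * v) ^ 3 / 3))) \<le> std_normal_density v" for n
      by (intro AE_I2) (simp add: abs_mult mult_left_le)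
  qed auto
  ultimately have "(LBINT p. std_normal_density 0 * airy_osc 0 0 c p) = sqrt (2 * pi) * (LBINT v. std_normal_density v * 1)"
    by (simp only: mollified [OF positive_imp_inverse_positive [OF of_nat_0_less_iff [THEN iffD2, OF zero_less_Suc]]])
       (rule LIMSEQ_unique)
  \<comment> \<open>Here \<open>std_normal_density 0\<close> is \<open>1 / sqrt (2 * pi)\<close>, so
    the two roots combine to \<open>2 * pi\<close>.\<close>
  then have "std_normal_density 0 * integral\<^sup>L lborel (airy_osc 0 0 c) = sqrt (2 * pi)"
    by simp
  then show ?thesis
    by (simp add: std_normal_density_def field_simps)
qed

section \<open>Moments of the cubic exponential weight\<close>

text \<open>For \<open>\<beta> = b\<^sup>2\<close> this is \<open>s ^ k\<close> times the weight
  \<open>E\<close> of the overview; \<open>k\<close> also counts derivatives in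
  \<open>\<zeta>\<close>.\<close>

definition cubic_weight :: "nat \<Rightarrow> real \<Rightarrow> real \<Rightarrow> real \<Rightarrow> real" where
  "cubic_weight k \<beta> \<zeta> s = s ^ k * exp (s * \<zeta> - \<beta> * s\<^sup>2 / 2 - s ^ 3 / 3)"

definition cubic_moment :: "nat \<Rightarrow> real \<Rightarrow> real \<Rightarrow> real" where
  "cubic_moment k \<beta> \<zeta> = (LBINT s:{0<..}. cubic_weight k \<beta> \<zeta> s)"

lemma continuous_on_cubic_weight: "continuous_on S (cubic_weight k \<beta> \<zeta>)"
  unfolding cubic_weight_def by (intro continuous_intros) auto

lemma cubic_weight_measurable [measurable]: "cubic_weight k \<beta> \<zeta> \<in> borel_measurable borel"
  by (intro borel_measurable_continuous_onI continuous_on_cubic_weight)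

lemma cubic_weight_nonneg: "s \<ge> 0 \<Longrightarrow> 0 \<le> cubic_weight k \<beta> \<zeta> s"
  by (simp add: cubic_weight_def)

lemma cubic_weight_mono:
  assumes "s \<ge> 0" "\<zeta> \<le> \<eta>"
  shows "cubic_weight k \<beta> \<zeta> s \<le> cubic_weight k \<beta> \<eta> s"
  unfolding cubic_weight_def using assms by (intro mult_left_mono) (auto intro: mult_left_mono)

lemma abs_cubic_weight_le:
  assumes "s \<ge> 0" "\<bar>\<zeta>\<bar> \<le> M"
  shows "\<bar>cubic_weight k \<beta> \<zeta> s\<bar> \<le> \<bar>s\<bar> ^ k * exp (M * \<bar>s\<bar> - (\<beta> / 2) * s\<^sup>2)"
proof -
  have "s * \<zeta> \<le> M * s"
    using assms mult_left_mono [of \<zeta> M s] by (simp add: mult.commute)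
  moreover have "s ^ 3 \<ge> 0"
    using assms by simp
  ultimately have "s * \<zeta> - \<beta> * s\<^sup>2 / 2 - s ^ 3 / 3 \<le> M * s - (\<beta> / 2) * s\<^sup>2"
    by linarith
  then show ?thesis
    using assms by (simp add: cubic_weight_def abs_mult mult_left_mono)
qed

lemma set_integrable_cubic_weight:
  assumes "\<beta> > 0"
  shows "set_integrable lborel {0<..} (cubic_weight k \<beta> \<zeta>)"
  unfolding set_integrable_def
proof (rule Bochner_Integration.integrable_bound)
  show "integrable lborel (\<lambda>s. \<bar>s\<bar> ^ k * exp (\<bar>\<zeta>\<bar> * \<bar>s\<bar> - (\<beta> / 2) * s\<^sup>2))"
    using assms by (intro integrable_power_gaussian) simp
  show "AE s in lborel. norm (indicator {0<..} s *\<^sub>R cubic_weight k \<beta> \<zeta> s)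
      \<le> norm (\<bar>s\<bar> ^ k * exp (\<bar>\<zeta>\<bar> * \<bar>s\<bar> - (\<beta> / 2) * s\<^sup>2))"
    using abs_cubic_weight_le [of _ \<zeta> "\<bar>\<zeta>\<bar>" k \<beta>]
    by (intro AE_I2) (simp add: indicator_def abs_mult)
qed simp

lemma DERIV_cubic_moment:
  assumes "\<beta> > 0"
  shows "(cubic_moment k \<beta> has_real_derivative cubic_moment (Suc k) \<beta> \<zeta>) (at \<zeta>)"
  unfolding cubic_moment_def set_lebesgue_integral_def
proof (rule has_real_derivative_lebesgue_integral [where e = 1 and
      f = "\<lambda>\<zeta> s. indicator {0<..} s *\<^sub>R cubic_weight k \<beta> \<zeta> s" and
      f' = "\<lambda>\<zeta> s. indicator {0<..} s *\<^sub>R cubic_weight (Suc k) \<beta> \<zeta> s"])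
  show "integrable lborel (\<lambda>s. indicator {0<..} s *\<^sub>R cubic_weight k \<beta> y s)" for y
    using set_integrable_cubic_weight [OF assms] by (simp add: set_integrable_def)
  show "((\<lambda>y. indicator {0<..} s *\<^sub>R cubic_weight k \<beta> y s) has_real_derivative
      indicator {0<..} s *\<^sub>R cubic_weight (Suc k) \<beta> y s) (at y)" for y s :: real
    unfolding cubic_weight_def by (auto intro!: derivative_eq_intros)
  show "integrable lborel (\<lambda>s. \<bar>s\<bar> ^ Suc k * exp ((\<bar>\<zeta>\<bar> + 1) * \<bar>s\<bar> - (\<beta> / 2) * s\<^sup>2))"
    using assms by (intro integrable_power_gaussian) simp
  show "\<bar>indicator {0<..} s *\<^sub>R cubic_weight (Suc k) \<beta> y s\<bar>
      \<le> \<bar>s\<bar> ^ Suc k * exp ((\<bar>\<zeta>\<bar> + 1) * \<bar>s\<bar> - (\<beta> / 2) * s\<^sup>2)" if "\<bar>y - \<zeta>\<bar> < 1" for y s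
    using abs_cubic_weight_le [of s y "\<bar>\<zeta>\<bar> + 1" "Suc k" \<beta>] that
    by (cases "s > 0") (auto simp: indicator_def simp del: power_Suc)
qed simp_all

lemma tendsto_cubic_weight:
  assumes "\<beta> > 0"
  shows "(cubic_weight k \<beta> \<zeta> \<longlongrightarrow> 0) at_top"
proof (rule Lim_null_comparison)
  show "\<forall>\<^sub>F s in at_top. norm (cubic_weight k \<beta> \<zeta> s) \<le> \<bar>s\<bar> ^ k * exp (\<bar>\<zeta>\<bar> * \<bar>s\<bar> - (\<beta> / 2) * s\<^sup>2)"
    using eventually_ge_at_top [of 0] by eventually_elim (use abs_cubic_weight_le in simp)
  show "((\<lambda>s. \<bar>s\<bar> ^ k * exp (\<bar>\<zeta>\<bar> * \<bar>s\<bar> - (\<beta> / 2) * s\<^sup>2)) \<longlongrightarrow> 0) at_top"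
    using tendsto_power_gaussian [of "\<beta> / 2" k "\<bar>\<zeta>\<bar>"] assms
    by (auto intro: tendsto_mono at_top_le_at_infinity)
qed

text \<open>The total derivatives of \<open>E\<close> and of \<open>s E\<close> are integrated over
  the half-line. Both functions vanish at infinity; at 0 the first equals 1 and the second 0. The
  first identity is also the inhomogeneous differential equation for
  \<open>cubic_moment 0 \<beta>\<close>.\<close>

lemma
  assumes "\<beta> > 0"
  shows cubic_moment_0: "\<zeta> * cubic_moment 0 \<beta> \<zeta> - \<beta> * cubic_moment 1 \<beta> \<zeta> - cubic_moment 2 \<beta> \<zeta> = - 1"
    and cubic_moment_1: "cubic_moment 0 \<beta> \<zeta> + \<zeta> * cubic_moment 1 \<beta> \<zeta> - \<beta> * cubic_moment 2 \<beta> \<zeta> - cubic_moment 3 \<beta> \<zeta> = 0"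
proof -
  let ?w = "\<lambda>k. cubic_weight k \<beta> \<zeta>"
  note int = set_integrable_cubic_weight [OF assms]
  have "(LBINT s:{0<..}. \<zeta> * ?w 0 s - \<beta> * ?w 1 s - ?w 2 s) = 0 - ?w 0 0"
  proof (rule set_integral_FTC_Ioi)
    show "(?w 0 has_real_derivative \<zeta> * ?w 0 s - \<beta> * ?w 1 s - ?w 2 s) (at s)" for s
      unfolding cubic_weight_def by (auto intro!: derivative_eq_intros simp: algebra_simps)
    show "continuous_on UNIV (\<lambda>s. \<zeta> * ?w 0 s - \<beta> * ?w 1 s - ?w 2 s)"
      by (intro continuous_intros continuous_on_cubic_weight)
    show "set_integrable lborel {0<..} (\<lambda>s. \<zeta> * ?w 0 s - \<beta> * ?w 1 s - ?w 2 s)"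
      by (intro set_integral_diff set_integrable_mult_right int)
  qed (rule tendsto_cubic_weight [OF assms])
  then show "\<zeta> * cubic_moment 0 \<beta> \<zeta> - \<beta> * cubic_moment 1 \<beta> \<zeta> - cubic_moment 2 \<beta> \<zeta> = - 1"
    by (simp add: cubic_moment_def set_integral_diff int cubic_weight_def [of 0 _ _ 0])
  have "(LBINT s:{0<..}. ?w 0 s + \<zeta> * ?w 1 s - \<beta> * ?w 2 s - ?w 3 s) = 0 - ?w 1 0"
  proof (rule set_integral_FTC_Ioi)
    show "(?w 1 has_real_derivative ?w 0 s + \<zeta> * ?w 1 s - \<beta> * ?w 2 s - ?w 3 s) (at s)" for s
      unfolding cubic_weight_def
      by (auto intro!: derivative_eq_intros simp: algebra_simps power2_eq_square power3_eq_cube)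
    show "continuous_on UNIV (\<lambda>s. ?w 0 s + \<zeta> * ?w 1 s - \<beta> * ?w 2 s - ?w 3 s)"
      by (intro continuous_intros continuous_on_cubic_weight)
    show "set_integrable lborel {0<..} (\<lambda>s. ?w 0 s + \<zeta> * ?w 1 s - \<beta> * ?w 2 s - ?w 3 s)"
      by (intro set_integral_diff set_integral_add set_integrable_mult_right int)
  qed (rule tendsto_cubic_weight [OF assms])
  then show "cubic_moment 0 \<beta> \<zeta> + \<zeta> * cubic_moment 1 \<beta> \<zeta> - \<beta> * cubic_moment 2 \<beta> \<zeta> - cubic_moment 3 \<beta> \<zeta> = 0"
    by (simp add: cubic_moment_def set_integral_diff set_integral_add int cubic_weight_def [of "Suc 0" _ _ 0])
qed

lemma cubic_moment_nonneg: "0 \<le> cubic_moment k \<beta> \<zeta>"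
  unfolding cubic_moment_def set_lebesgue_integral_def
  by (intro Bochner_Integration.integral_nonneg) (simp add: indicator_def cubic_weight_nonneg)

text \<open>Lets the values at 0 bound the moments at all negative \<open>\<zeta>\<close> when the
  limit at \<open>-\<infinity>\<close> is taken.\<close>

lemma cubic_moment_mono:
  assumes "\<beta> > 0" "\<zeta> \<le> \<eta>"
  shows "cubic_moment k \<beta> \<zeta> \<le> cubic_moment k \<beta> \<eta>"
  unfolding cubic_moment_def
  by (intro set_integral_mono set_integrable_cubic_weight cubic_weight_mono assms) auto

text \<open>The left-hand side is an antiderivative of \<open>airy_osc 0 0 c\<close> that vanishes at \<open>-\<infinity>\<close>.\<close>

lemma airy_osc_cubic_moment:
  assumes "c > 0"
  defines "\<beta> \<equiv> 2 * c"
  shows "airy_osc 0 0 c \<zeta> * (cubic_moment 1 \<beta> \<zeta> + \<beta> * cubic_moment 0 \<beta> \<zeta>)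
      - airy_osc 1 (pi / 2) c \<zeta> * cubic_moment 0 \<beta> \<zeta>
    = 2 * pi - (LBINT p:{\<zeta>..}. airy_osc 0 0 c p)"
proof -
  let ?a0 = "airy_osc 0 0 c" and ?a1 = "airy_osc 1 (pi / 2) c" and ?a2 = "airy_osc 2 pi c"
  let ?m = "\<lambda>k. cubic_moment k \<beta>"
  have \<beta>: "\<beta> > 0"
    using assms by simp
  \<comment> \<open>The bilinear concomitant of \<open>a'' - \<beta> a' - \<zeta> a\<close> and its
    adjoint \<open>F'' + \<beta> F' - \<zeta> F\<close>. The first expression is 0 for
    \<open>?a0\<close> and the second is 1 for \<open>?m 0\<close>, so the derivative of
    \<open>H\<close> reduces to \<open>?a0\<close>.\<close>
  define H where "H = (\<lambda>\<zeta>. ?a0 \<zeta> * (?m 1 \<zeta> + \<beta> * ?m 0 \<zeta>) - ?a1 \<zeta> * ?m 0 \<zeta>)"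
  have H: "(H has_real_derivative ?a0 \<zeta>) (at \<zeta>)" for \<zeta>
  proof -
    have "(?a0 has_real_derivative ?a1 \<zeta>) (at \<zeta>)" "(?a1 has_real_derivative ?a2 \<zeta>) (at \<zeta>)"
      using DERIV_airy_osc [OF assms(1), of 0 0] DERIV_airy_osc [OF assms(1), of 1 "pi / 2"]
      by (simp_all add: numeral_2_eq_2)
    moreover have "(?m 0 has_real_derivative ?m 1 \<zeta>) (at \<zeta>)" "(?m 1 has_real_derivative ?m 2 \<zeta>) (at \<zeta>)"
      using DERIV_cubic_moment [OF \<beta>, of 0] DERIV_cubic_moment [OF \<beta>, of 1]
      by (simp_all add: numeral_2_eq_2)
    ultimately have "(H has_real_derivative ?a1 \<zeta> * (?m 1 \<zeta> + \<beta> * ?m 0 \<zeta>) + ?a0 \<zeta> * (?m 2 \<zeta> + \<beta> * ?m 1 \<zeta>)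
        - (?a2 \<zeta> * ?m 0 \<zeta> + ?a1 \<zeta> * ?m 1 \<zeta>)) (at \<zeta>)"
      unfolding H_def by (auto intro!: derivative_eq_intros)
    also have "?a1 \<zeta> * (?m 1 \<zeta> + \<beta> * ?m 0 \<zeta>) + ?a0 \<zeta> * (?m 2 \<zeta> + \<beta> * ?m 1 \<zeta>)
        - (?a2 \<zeta> * ?m 0 \<zeta> + ?a1 \<zeta> * ?m 1 \<zeta>) = ?a0 \<zeta>"
    proof -
      have "?m 2 \<zeta> + \<beta> * ?m 1 \<zeta> = \<zeta> * ?m 0 \<zeta> + 1"
        using cubic_moment_0 [OF \<beta>, of \<zeta>] by simp
      moreover have "?a2 \<zeta> = \<beta> * ?a1 \<zeta> + \<zeta> * ?a0 \<zeta>"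
        using airy_osc_ode [OF assms(1), of \<zeta>] by (simp add: \<beta>_def)
      ultimately show ?thesis
        by (simp add: algebra_simps)
    qed
    finally show ?thesis .
  qed
  have lim: "(H \<longlongrightarrow> 0) at_bot"
  proof -
    obtain K where K: "\<And>\<zeta>. \<bar>?a0 \<zeta>\<bar> \<le> K * exp ((c - c / 2) * \<zeta>)" "\<And>\<zeta>. \<bar>?a1 \<zeta>\<bar> \<le> K * exp ((c - c / 2) * \<zeta>)"
      by (rule airy_osc_exp_bound [of c "c / 2"]) (use assms in auto)
    \<comment> \<open>Height \<open>c / 2\<close> makes both oscillatory factors decay at
      \<open>-\<infinity>\<close>, while the nonnegative moments stay below their values at
      0.\<close>
    let ?M = "?m 1 0 + \<beta> * ?m 0 0 + ?m 0 0"
    show ?thesis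
    proof (rule Lim_null_comparison)
      show "\<forall>\<^sub>F \<zeta> in at_bot. norm (H \<zeta>) \<le> K * exp ((c - c / 2) * \<zeta>) * ?M"
        using eventually_le_at_bot [of 0]
      proof eventually_elim
        case (elim \<zeta>)
        let ?e = "K * exp ((c - c / 2) * \<zeta>)"
        have m: "0 \<le> ?m 1 \<zeta> + \<beta> * ?m 0 \<zeta>" "0 \<le> ?m 0 \<zeta>"
          "?m 1 \<zeta> + \<beta> * ?m 0 \<zeta> \<le> ?m 1 0 + \<beta> * ?m 0 0" "?m 0 \<zeta> \<le> ?m 0 0"
          using \<beta> elim by (auto intro!: add_nonneg_nonneg mult_nonneg_nonneg add_mono mult_left_mono cubic_moment_nonneg cubic_moment_mono)
        have "0 \<le> ?e"
          using K(1) [of \<zeta>] by linarith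
        have "norm (H \<zeta>) \<le> \<bar>?a0 \<zeta>\<bar> * (?m 1 \<zeta> + \<beta> * ?m 0 \<zeta>) + \<bar>?a1 \<zeta>\<bar> * ?m 0 \<zeta>"
          unfolding H_def real_norm_def using m
          by (intro order_trans [OF abs_triangle_ineq4]) (simp add: abs_mult)
        also have "\<dots> \<le> ?e * (?m 1 0 + \<beta> * ?m 0 0) + ?e * ?m 0 0"
          by (rule add_mono [OF mult_mono mult_mono]) (simp_all only: K m \<open>0 \<le> ?e\<close>)
        finally show ?case
          by (simp add: algebra_simps)
      qed
      have "filterlim (\<lambda>\<zeta>. (c - c / 2) * \<zeta>) at_bot at_bot"
        using assms by (intro filterlim_tendsto_pos_mult_at_bot [OF tendsto_const] filterlim_ident) simp
      then show "((\<lambda>\<zeta>. K * exp ((c - c / 2) * \<zeta>) * ?M) \<longlongrightarrow> 0) at_bot"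
        by (intro tendsto_mult_left_zero tendsto_mult_right_zero filterlim_compose [OF exp_at_bot])
    qed
  qed
  have int: "set_integrable lborel S ?a0" if "S \<in> sets borel" for S
    unfolding set_integrable_def using that integrable_airy_osc [OF assms(1)]
    by (intro integrable_mult_indicator) auto
  have "(LBINT p:{..<\<zeta>}. ?a0 p) = H \<zeta> - 0"
  proof (rule set_integral_FTC_Iio [OF H _ _ lim])
    show "continuous_on UNIV ?a0"
      by (intro continuous_at_imp_continuous_on ballI isCont_airy_osc assms)
  qed (rule int, simp)
  moreover have "(LBINT p:{..<\<zeta>} \<union> {\<zeta>..}. ?a0 p) = (LBINT p:{..<\<zeta>}. ?a0 p) + (LBINT p:{\<zeta>..}. ?a0 p)"
    by (intro set_integral_Un int) auto
  moreover have "{..<\<zeta>} \<union> {\<zeta>..} = UNIV"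
    by auto
  ultimately show ?thesis
    using integral_airy_osc [OF assms(1)] by (simp add: H_def set_lebesgue_integral_def)
qed

section \<open>Inversion of the variable \<open>t\<close> and evaluation of the density\<close>

text \<open>The map \<open>t\<close> to \<open>\<beta> / t\<close> is a bijection of the positive
  half-line with absolute Jacobian \<open>\<beta> / t\<^sup>2\<close>. The change of variables takes
  place in the completed measure; Borel measurability of \<open>f\<close> brings the result back to
  \<open>lborel\<close>.\<close>

lemma set_integral_substitution_inverse:
  fixes f :: "real \<Rightarrow> real"
  assumes "\<beta> > 0" and f: "set_integrable lborel {0<..} f" "f \<in> borel_measurable borel"
  shows "set_integrable lborel {0<..} (\<lambda>t. \<beta> / t\<^sup>2 * f (\<beta> / t))"
    and "(LBINT t:{0<..}. \<beta> / t\<^sup>2 * f (\<beta> / t)) = (LBINT s:{0<..}. f s)"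
proof -
  have image: "(\<lambda>t. \<beta> / t) ` {0<..} = {0<..}"
  proof
    show "{0<..} \<subseteq> (\<lambda>t. \<beta> / t) ` {0<..}"
    proof
      fix s :: real assume "s \<in> {0<..}"
      then show "s \<in> (\<lambda>t. \<beta> / t) ` {0<..}"
        using assms(1) by (intro image_eqI [of _ _ "\<beta> / s"]) auto
    qed
  qed (use assms(1) in auto)
  have "f absolutely_integrable_on {0<..}"
    using f unfolding set_integrable_def by (subst integrable_completion) auto
  moreover have "integral {0<..} f = (LBINT s:{0<..}. f s)"
    using f(1) by (rule set_borel_integral_eq_integral(2) [symmetric])
  moreover have "(\<lambda>t. \<bar>- \<beta> / t\<^sup>2\<bar> * f (\<beta> / t)) absolutely_integrable_on {0<..} \<and>
      integral {0<..} (\<lambda>t. \<bar>- \<beta> / t\<^sup>2\<bar> * f (\<beta> / t)) = (LBINT s:{0<..}. f s)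
    \<longleftrightarrow> f absolutely_integrable_on (\<lambda>t. \<beta> / t) ` {0<..} \<and> integral ((\<lambda>t. \<beta> / t) ` {0<..}) f = (LBINT s:{0<..}. f s)"
  proof (rule has_absolute_integral_change_of_variables_1')
    show "((\<lambda>t. \<beta> / t) has_real_derivative - \<beta> / t\<^sup>2) (at t within {0<..})" if "t \<in> {0<..}" for t
      using that by (auto intro!: derivative_eq_intros simp: power2_eq_square)
    show "inj_on (\<lambda>t. \<beta> / t) {0<..}"
      using assms(1) by (auto simp: inj_on_def field_simps)
  qed simp
  moreover have "\<bar>\<beta>\<bar> = \<beta>"
    using assms(1) by simp
  ultimately have *: "(\<lambda>t. \<beta> / t\<^sup>2 * f (\<beta> / t)) absolutely_integrable_on {0<..}"
    "integral {0<..} (\<lambda>t. \<beta> / t\<^sup>2 * f (\<beta> / t)) = (LBINT s:{0<..}. f s)"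
    by (simp_all add: image)
  show "set_integrable lborel {0<..} (\<lambda>t. \<beta> / t\<^sup>2 * f (\<beta> / t))"
    using *(1) f(2) unfolding set_integrable_def by (subst (asm) integrable_completion) auto
  then show "(LBINT t:{0<..}. \<beta> / t\<^sup>2 * f (\<beta> / t)) = (LBINT s:{0<..}. f s)"
    using *(2) by (simp add: set_borel_integral_eq_integral(2))
qed

text \<open>A Bochner integral is 0 by default for a non-integrable function, so integrability is
  asserted alongside the value of \<open>rho\<close>.\<close>

theorem corollary2p2:
  fixes b \<zeta> :: real
  assumes "b > 0"
  shows "set_integrable lborel {0<..} (P_we b \<zeta>) \<and>
    rho b \<zeta> = (LBINT p:{\<zeta>..}. (Ai_deformed b p)^2)
      + 1/2 * Ai_deformed b \<zeta> * (1 - (LBINT p:{\<zeta>..}. Ai_deformed b p))"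
proof -
  define \<beta> where "\<beta> = b\<^sup>2"
  have \<beta>: "\<beta> > 0" "\<beta> / 2 > 0" "2 * (\<beta> / 2) = \<beta>"
    using assms by (simp_all add: \<beta>_def)
  have A: "Ai_deformed b = (\<lambda>\<zeta>. airy_osc 0 0 (\<beta> / 2) \<zeta> / (2 * pi))"
    using Ai_deformed_eq_airy_osc [OF assms] by (auto simp: \<beta>_def)
  have "(Ai_deformed b has_real_derivative airy_osc 1 (pi / 2) (\<beta> / 2) \<zeta> / (2 * pi)) (at \<zeta>)"
    unfolding A using DERIV_airy_osc [OF \<beta>(2), of 0 0 \<zeta>] by (intro DERIV_cdivide) simp
  then have A': "deriv (Ai_deformed b) \<zeta> = airy_osc 1 (pi / 2) (\<beta> / 2) \<zeta> / (2 * pi)"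
    by (rule DERIV_imp_deriv)
  let ?w = "\<lambda>k. cubic_weight k \<beta> \<zeta>" and ?m = "\<lambda>k. cubic_moment k \<beta> \<zeta>"
  define Q where "Q = (\<lambda>s. T0 b \<zeta> * ?w 0 s + T1 b \<zeta> * ?w 1 s + T2 b \<zeta> * ?w 2 s + T3 b \<zeta> * ?w 3 s)"
  note int = set_integrable_cubic_weight [OF \<beta>(1)]
  have Q: "set_integrable lborel {0<..} Q"
    unfolding Q_def by (intro set_integral_add set_integrable_mult_right int)
  have Q_meas: "Q \<in> borel_measurable borel"
    unfolding Q_def by measurable
  \<comment> \<open>With \<open>s = \<beta> / t\<close>, each factor \<open>b\<^sup>2 / t\<close>
    inside the bracket becomes \<open>s\<close>, and the outer \<open>b\<^sup>2 / t\<^sup>2\<close>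
    is the Jacobian.\<close>
  have P: "P_we b \<zeta> t = \<beta> / t\<^sup>2 * Q (\<beta> / t)" if "t > 0" for t
  proof -
    have "\<beta> / t * \<zeta> - \<beta> * (\<beta> / t)\<^sup>2 / 2 - (\<beta> / t) ^ 3 / 3 = b\<^sup>2 * \<zeta> / t - b ^ 6 / (2 * t\<^sup>2) - b ^ 6 / (3 * t ^ 3)"
      by (simp add: \<beta>_def power_divide flip: power_add power_mult)
    then show ?thesis
      by (simp add: P_we_def Q_def cubic_weight_def \<beta>_def power_divide algebra_simps flip: power_mult)
  qed
  have "set_integrable lborel {0<..} (P_we b \<zeta>)"
    using set_integral_substitution_inverse(1) [OF \<beta>(1) Q Q_meas]
    by (subst set_integrable_cong [OF refl refl P]) auto
  moreover have "rho b \<zeta> = (LBINT s:{0<..}. Q s)"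
    unfolding rho_def set_integral_substitution_inverse(2) [OF \<beta>(1) Q Q_meas, symmetric]
    by (intro set_lebesgue_integral_cong) (auto simp: P)
  moreover have "(LBINT s:{0<..}. Q s) = T0 b \<zeta> * ?m 0 + T1 b \<zeta> * ?m 1 + T2 b \<zeta> * ?m 2 + T3 b \<zeta> * ?m 3"
    unfolding Q_def cubic_moment_def by (simp add: set_integral_add int)
  moreover have "\<dots> = (LBINT p:{\<zeta>..}. (Ai_deformed b p)\<^sup>2)
      + 1/2 * Ai_deformed b \<zeta> * (1 - (LBINT p:{\<zeta>..}. Ai_deformed b p))"
  proof -
    have G: "Ai_deformed b \<zeta> * (?m 1 + \<beta> * ?m 0) - deriv (Ai_deformed b) \<zeta> * ?m 0 =
        1 - (LBINT p:{\<zeta>..}. Ai_deformed b p)"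
    proof -
      have "Ai_deformed b \<zeta> * (?m 1 + \<beta> * ?m 0) - deriv (Ai_deformed b) \<zeta> * ?m 0 =
          (airy_osc 0 0 (\<beta> / 2) \<zeta> * (?m 1 + \<beta> * ?m 0) - airy_osc 1 (pi / 2) (\<beta> / 2) \<zeta> * ?m 0) / (2 * pi)"
        unfolding A' unfolding A by (simp add: diff_divide_distrib)
      also have "\<dots> = (2 * pi - (LBINT p:{\<zeta>..}. airy_osc 0 0 (\<beta> / 2) p)) / (2 * pi)"
        using airy_osc_cubic_moment [OF \<beta>(2), of \<zeta>] by (simp only: \<beta>(3))
      also have "\<dots> = 1 - (LBINT p:{\<zeta>..}. Ai_deformed b p)"
        unfolding A by (simp add: diff_divide_distrib)
      finally show ?thesis .
    qed
    have m2: "?m 2 = \<zeta> * ?m 0 - \<beta> * ?m 1 + 1" and m3: "?m 3 = ?m 0 + \<zeta> * ?m 1 - \<beta> * ?m 2"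
      using cubic_moment_0 [OF \<beta>(1), of \<zeta>] cubic_moment_1 [OF \<beta>(1), of \<zeta>] by simp_all
    \<comment> \<open>Eliminating \<open>?m 3\<close> cancels the coefficient of \<open>T3\<close>,
      and eliminating \<open>?m 2\<close> reduces that of the integral of the square to 1; the terms
      left over form the combination in \<open>G\<close>.\<close>
    have "T0 b \<zeta> * ?m 0 + T1 b \<zeta> * ?m 1 + T2 b \<zeta> * ?m 2 + T3 b \<zeta> * ?m 3 =
        (LBINT p:{\<zeta>..}. (Ai_deformed b p)\<^sup>2) + 1/2 * Ai_deformed b \<zeta> *
        (Ai_deformed b \<zeta> * (?m 1 + \<beta> * ?m 0) - deriv (Ai_deformed b) \<zeta> * ?m 0)"
      unfolding T0_def T1_def T2_def \<beta>_def [symmetric] m3 m2 by algebra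
    then show ?thesis
      unfolding G .
  qed
  ultimately show ?thesis
    by simp
qed

end
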